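(* For an integer $n\ge 2$ and $c\in\mathbb{C}$ let $P_{n,c}(z)=z^n+c$, let $K(P_{n,c})$ be its filled Julia set and $J(P_{n,c})=\partial K(P_{n,c})$ its Julia set. Let $c\in\mathbb{C}$. (1) If $c\in\mathbb{C}\setminus\overline{\mathbb{D}}$, then $\lim_{n\to\infty}J(P_{n,c})=\lim_{n\to\infty}K(P_{n,c})=S^1$. (2) If $c\in\mathbb{D}$, then $\lim_{n\to\infty}J(P_{n,c})=S^1$ and $\lim_{n\to\infty}K(P_{n,c})=\overline{\mathbb{D}}$. (3) If $c\in S^1$, then if $\lim_{n\to\infty}J(P_{n,c})$ and/or $\lim_{n\to\infty}K(P_{n,c})$ (and/or any liminf or limsup of these sequences of sets) exists, it is contained in $\overline{\mathbb{D}}$.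
   Context: $\mathbb{D}$ is the open unit disk in $\mathbb{C}$, $\overline{\mathbb{D}}$ its closure, $S^1$ the unit circle. $K(P_{n,c})=\{z\in\mathbb{C} : \{P_{n,c}^m(z)\}_{m=1}^\infty\text{ is bounded}\}$, where $P_{n,c}^m$ is the $m$-th iterate. Limits of compact sets are in the Hausdorff metric $d_{\mathcal{H}}(A,B)=\max\{\sup_{a\in A}\inf_{b\in B}d(a,b),\ \sup_{b\in B}\inf_{a\in A}d(a,b)\}$: $\lim_{n\to\infty}S_n=S$ means that for all $\epsilon>0$ there is $N$ with $d_{\mathcal{H}}(S_n,S)<\epsilon$ for all $n\ge N$. The limsup (resp. liminf) of a sequence of sets $S_n$ is understood as the set of points $z$ every neighborhood of which meets $S_n$ for infinitely many $n$ (resp. for all sufficiently large $n$). *)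

theory Defs
  imports "HOL-Analysis.Analysis"
begin

definition P :: "nat \<Rightarrow> complex \<Rightarrow> complex \<Rightarrow> complex" where
  "P n c z = z ^ n + c"

definition filled_Julia :: "(complex \<Rightarrow> complex) \<Rightarrow> complex set" where
  "filled_Julia f = {z. bounded ((\<lambda>m. (f ^^ m) z) ` {1..})}"

definition Julia :: "(complex \<Rightarrow> complex) \<Rightarrow> complex set" where
  "Julia f = frontier (filled_Julia f)"

(* Extended nonnegative real values make the formula meaningful for all sets: the distance is
   infinite if a supremum is unbounded or if exactly one of the sets is empty.  On nonempty
   compact sets it is the usual real-valued Hausdorff metric. *)
definition hausdorff_distance :: "'a::metric_space set \<Rightarrow> 'a set \<Rightarrow> ennreal" where
  "hausdorff_distance A B =
     max (SUP a\<in>A. INF b\<in>B. ennreal (dist a b)) (SUP b\<in>B. INF a\<in>A. ennreal (dist a b))"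

definition hausdorff_limit :: "(nat \<Rightarrow> 'a::metric_space set) \<Rightarrow> 'a set \<Rightarrow> bool" where
  "hausdorff_limit S L \<longleftrightarrow>
     (\<forall>\<epsilon>::real. \<epsilon> > 0 \<longrightarrow> (\<exists>N. \<forall>n\<ge>N. hausdorff_distance (S n) L < ennreal \<epsilon>))"

(* These are the topological (Kuratowski) limits of a sequence of sets, not the set-theoretic
   limsup and liminf of the complete lattice of sets. *)
definition set_limsup :: "(nat \<Rightarrow> 'a::topological_space set) \<Rightarrow> 'a set" where
  "set_limsup S = {z. \<forall>U. open U \<and> z \<in> U \<longrightarrow> infinite {n. U \<inter> S n \<noteq> {}}}"

definition set_liminf :: "(nat \<Rightarrow> 'a::topological_space set) \<Rightarrow> 'a set" where
  "set_liminf S = {z. \<forall>U. open U \<and> z \<in> U \<longrightarrow> (\<exists>N. \<forall>n\<ge>N. U \<inter> S n \<noteq> {})}"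

(* The sequences are indexed by all natural numbers although the family is only of interest for
   degrees n at least 2.  All the limit notions above depend only on the tail of a sequence, so the
   terms with index 0 and 1 are irrelevant. *)
abbreviation Kseq :: "complex \<Rightarrow> nat \<Rightarrow> complex set" where
  "Kseq c \<equiv> \<lambda>n. filled_Julia (P n c)"

abbreviation Jseq :: "complex \<Rightarrow> nat \<Rightarrow> complex set" where
  "Jseq c \<equiv> \<lambda>n. Julia (P n c)"

end

theory Submission
  imports Defs "HOL-Computational_Algebra.Fundamental_Theorem_Algebra"
begin

text \<open>
  Three elementary facts carry the theorem.  First, \<open>z ^ n\<close> is enormous for large \<open>n\<close> as soon as
  \<open>norm z\<close> exceeds \<open>1\<close> by a fixed amount, whatever \<open>c\<close> is; so the filled Julia sets are eventually
  contained in every disk of radius \<open>R > 1\<close> (lemma \<open>eventually_filled_Julia_subset_ball\<close>).  This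
  alone gives the claim for \<open>c\<close> on the unit circle, because a Hausdorff limit consists of points
  of the Kuratowski lower limit.  Second, \<open>z ^ n\<close> is tiny when \<open>norm z\<close> is below \<open>1\<close> by a fixed
  amount, so the disk of radius \<open>r < 1\<close> is mapped to a small neighbourhood of \<open>c\<close>.  If \<open>norm c > 1\<close>,
  that neighbourhood lies in the escape region and the disk misses the filled Julia set; if
  \<open>norm c < 1\<close>, it lies in the disk again (for \<open>r\<close> close to \<open>1\<close>) and the disk is contained in the
  filled Julia set.  In both cases the Julia set is squeezed into a thin annulus around the unit
  circle.

  Third, the Julia set comes close to every point of the circle, for reasons of symmetry: the
  polynomial takes the same value at \<open>z\<close> and at \<open>w * z\<close> when \<open>w ^ n = 1\<close>, so the Julia set is
  invariant under rotation by the angle \<open>2 * pi / n\<close>.  A single point of it in the annulus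
  therefore produces a whole regular \<open>n\<close>-gon of points, and these polygons become dense in the
  circle (lemma \<open>hausdorff_limit_sphere\<close>).  That there is at least one point follows from the
  existence of a fixed point and the boundedness of the filled Julia set.
\<close>

section \<open>Hausdorff and Kuratowski limits\<close>

lemma hausdorff_distance_le:
  assumes "\<And>a. a \<in> A \<Longrightarrow> \<exists>b\<in>B. dist a b \<le> e"
    and "\<And>b. b \<in> B \<Longrightarrow> \<exists>a\<in>A. dist a b \<le> e"
  shows "hausdorff_distance A B \<le> ennreal e"
  unfolding hausdorff_distance_def
proof (intro max.boundedI SUP_least)
  fix a assume "a \<in> A"
  then obtain b where "b \<in> B" "dist a b \<le> e" using assms(1) by blast
  then show "(INF b\<in>B. ennreal (dist a b)) \<le> ennreal e"
    by (intro INF_lower2[of b]) (auto intro: ennreal_leI)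
next
  fix b assume "b \<in> B"
  then obtain a where "a \<in> A" "dist a b \<le> e" using assms(2) by blast
  then show "(INF a\<in>A. ennreal (dist a b)) \<le> ennreal e"
    by (intro INF_lower2[of a]) (auto intro: ennreal_leI)
qed

lemma hausdorff_limitI:
  assumes "\<And>e. e > 0 \<Longrightarrow> \<forall>\<^sub>F n in sequentially.
      (\<forall>a\<in>S n. \<exists>b\<in>L. dist a b \<le> e) \<and> (\<forall>b\<in>L. \<exists>a\<in>S n. dist a b \<le> e)"
  shows "hausdorff_limit S L"
  unfolding hausdorff_limit_def
proof (intro allI impI)
  fix e :: real assume e: "e > 0"
  then obtain N where N: "\<And>n. n \<ge> N \<Longrightarrow>
      (\<forall>a\<in>S n. \<exists>b\<in>L. dist a b \<le> e / 2) \<and> (\<forall>b\<in>L. \<exists>a\<in>S n. dist a b \<le> e / 2)"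
    using assms[of "e / 2"] unfolding eventually_sequentially by auto
  have "hausdorff_distance (S n) L < ennreal e" if "n \<ge> N" for n
  proof -
    have "hausdorff_distance (S n) L \<le> ennreal (e / 2)"
      by (rule hausdorff_distance_le) (use N[OF that] in auto)
    also have "\<dots> < ennreal e" using e by (intro ennreal_lessI) auto
    finally show ?thesis .
  qed
  then show "\<exists>N. \<forall>n\<ge>N. hausdorff_distance (S n) L < ennreal e" by blast
qed

lemma hausdorff_distance_lessD:
  assumes "hausdorff_distance A B < ennreal e" and "b \<in> B"
  shows "\<exists>a\<in>A. dist a b < e"
proof -
  have "(INF a\<in>A. ennreal (dist a b)) \<le> hausdorff_distance A B"
    unfolding hausdorff_distance_def by (intro max.coboundedI2 SUP_upper assms(2))
  then have "(INF a\<in>A. ennreal (dist a b)) < ennreal e" using assms(1) by simp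
  then obtain a where "a \<in> A" "ennreal (dist a b) < ennreal e" by (auto simp: INF_less_iff)
  then show ?thesis by (auto simp: ennreal_less_iff)
qed

lemma hausdorff_limit_subset_set_liminf:
  assumes "hausdorff_limit S L"
  shows "L \<subseteq> set_liminf S"
  unfolding set_liminf_def
proof (intro subsetI CollectI allI impI)
  fix z U assume z: "z \<in> L" and U: "open U \<and> z \<in> U"
  then obtain e where e: "e > 0" "ball z e \<subseteq> U" by (meson openE)
  then obtain N where "\<And>n. n \<ge> N \<Longrightarrow> hausdorff_distance (S n) L < ennreal e"
    using assms unfolding hausdorff_limit_def by blast
  then have near: "\<exists>a\<in>S n. dist a z < e" if "n \<ge> N" for n
    using hausdorff_distance_lessD z that by blast
  have "U \<inter> S n \<noteq> {}" if n: "n \<ge> N" for n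
  proof -
    obtain a where "a \<in> S n" "dist a z < e" using near[OF n] by blast
    then have "a \<in> ball z e" by (simp add: dist_commute)
    then show ?thesis using \<open>a \<in> S n\<close> e(2) by blast
  qed
  then have "\<forall>n\<ge>N. U \<inter> S n \<noteq> {}" by blast
  then show "\<exists>N. \<forall>n\<ge>N. U \<inter> S n \<noteq> {}" by blast
qed

lemma set_liminf_subset_set_limsup: "set_liminf S \<subseteq> set_limsup S"
  unfolding set_liminf_def set_limsup_def
proof (intro subsetI CollectI allI impI)
  fix z U
  assume "z \<in> {z. \<forall>U. open U \<and> z \<in> U \<longrightarrow> (\<exists>N. \<forall>n\<ge>N. U \<inter> S n \<noteq> {})}" "open U \<and> z \<in> U"
  then obtain N where N: "\<forall>n\<ge>N. U \<inter> S n \<noteq> {}" by blast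
  have "infinite {N..}" by (rule infinite_Ici)
  moreover have "{N..} \<subseteq> {n. U \<inter> S n \<noteq> {}}" using N by auto
  ultimately show "infinite {n. U \<inter> S n \<noteq> {}}" using finite_subset by blast
qed

lemma set_limsup_subset_cball:
  fixes S :: "nat \<Rightarrow> 'a::real_normed_vector set"
  assumes "\<And>R. R > r \<Longrightarrow> \<forall>\<^sub>F n in sequentially. S n \<subseteq> cball 0 R"
  shows "set_limsup S \<subseteq> cball 0 r"
proof
  fix z assume z: "z \<in> set_limsup S"
  show "z \<in> cball 0 r"
  proof (rule ccontr)
    assume "z \<notin> cball 0 r"
    then have "r < norm z" by simp
    then obtain R where R: "r < R" "R < norm z" using dense by blast
    obtain N where N: "\<And>n. n \<ge> N \<Longrightarrow> S n \<subseteq> cball 0 R"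
      using assms[OF R(1)] unfolding eventually_sequentially by blast
    have "infinite {n. (- cball 0 R) \<inter> S n \<noteq> {}}"
      using z R(2) unfolding set_limsup_def by (auto simp: open_Compl)
    moreover have "{n. (- cball 0 R) \<inter> S n \<noteq> {}} \<subseteq> {..<N}"
    proof
      fix n assume "n \<in> {n. (- cball 0 R) \<inter> S n \<noteq> {}}"
      then have "\<not> S n \<subseteq> cball 0 R" by blast
      then show "n \<in> {..<N}" using N[of n] by (meson lessThan_iff not_le)
    qed
    ultimately show False using finite_subset by blast
  qed
qed

section \<open>Sets with rotational symmetry\<close>

text \<open>
  The \<open>n\<close>-th roots of unity split the circle into arcs of angle \<open>2 * pi / n\<close>, and a chord is
  shorter than its arc.
\<close>
lemma root_of_unity_near:
  fixes u :: complex
  assumes "norm u = 1" and "n > 0"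
  shows "\<exists>w. w ^ n = 1 \<and> dist w u \<le> 2 * pi / n"
proof -
  obtain t where u: "u = cis t" using assms(1) by (metis complex_norm_eq_1_exp cis_conv_exp)
  define k where "k = \<lfloor>t * n / (2 * pi)\<rfloor>"
  define s where "s = 2 * pi * k / n"
  have "(cis s) ^ n = cis (n * s)" by (rule Complex.DeMoivre)
  also have "n * s = 2 * pi * k" using assms(2) by (simp add: s_def)
  also have "cis (2 * pi * k) = 1" by (intro cis_multiple_2pi) auto
  finally have root: "(cis s) ^ n = 1" .
  have kt: "k \<le> t * n / (2 * pi)" "t * n / (2 * pi) < k + 1" unfolding k_def by linarith+
  have "s \<le> t" "t \<le> s + 2 * pi / n"
    using kt assms(2) by (auto simp: s_def field_simps)
  then have "\<bar>s - t\<bar> \<le> 2 * pi / n" by linarith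
  moreover have "dist (cis s) (cis t) \<le> \<bar>s - t\<bar>"
  proof -
    have "cis s - cis t = cis t * (exp (\<i> * of_real (s - t)) - 1)"
      unfolding cis_conv_exp[symmetric] by (simp add: right_diff_distrib cis_mult)
    then have "dist (cis s) (cis t) = 2 * \<bar>sin ((s - t) / 2)\<bar>"
      by (simp only: dist_norm norm_mult norm_cis dist_exp_i_1 mult_1)
    then show ?thesis using abs_sin_x_le_abs_x[of "(s - t) / 2"] by simp
  qed
  ultimately show ?thesis using root u by (metis order_trans)
qed

lemma dist_sgn_self:
  fixes z :: "'a::real_normed_vector"
  assumes "z \<noteq> 0"
  shows "dist z (sgn z) = \<bar>norm z - 1\<bar>"
proof -
  have "z - sgn z = (norm z - 1) *\<^sub>R sgn z"
    using assms by (simp add: sgn_div_norm algebra_simps)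
  then show ?thesis using assms by (simp add: dist_norm norm_sgn)
qed

text \<open>
  Thin annuli force the sets towards the circle; one point together with its rotates is enough to
  approximate the whole circle with an error of the width of the annulus plus \<open>2 * pi / n\<close>.
\<close>
lemma hausdorff_limit_sphere:
  fixes S :: "nat \<Rightarrow> complex set"
  assumes annulus: "\<And>e. \<lbrakk>0 < e; e < 1\<rbrakk> \<Longrightarrow>
      \<forall>\<^sub>F n in sequentially. \<forall>z\<in>S n. 1 - e \<le> norm z \<and> norm z \<le> 1 + e"
    and nonempty: "\<forall>\<^sub>F n in sequentially. S n \<noteq> {}"
    and rotation: "\<And>n w z. \<lbrakk>w ^ n = 1; z \<in> S n; n > 0\<rbrakk> \<Longrightarrow> w * z \<in> S n"
  shows "hausdorff_limit S (sphere 0 1)"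
proof (rule hausdorff_limitI)
  fix e :: real assume e: "e > 0"
  define d where "d = min (e / 2) (1 / 2)"
  have d: "0 < d" "d < 1" "d \<le> e / 2" using e by (auto simp: d_def)
  have "((\<lambda>n. 2 * pi / real n) \<longlonglongrightarrow> 0)" by (rule lim_const_over_n)
  then have "\<forall>\<^sub>F n in sequentially. 2 * pi / real n < e / 2"
    using e by (intro order_tendstoD) auto
  then show "\<forall>\<^sub>F n in sequentially. (\<forall>a\<in>S n. \<exists>b\<in>sphere 0 1. dist a b \<le> e) \<and>
      (\<forall>b\<in>sphere 0 1. \<exists>a\<in>S n. dist a b \<le> e)"
    using annulus[OF d(1,2)] nonempty eventually_gt_at_top[of 0]
  proof eventually_elim
    case (elim n)
    have close: "z \<noteq> 0 \<and> dist z (sgn z) \<le> d" if "z \<in> S n" for z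
    proof -
      have "1 - d \<le> norm z" "norm z \<le> 1 + d" using elim(2) that by auto
      moreover from this have "z \<noteq> 0" using d by auto
      ultimately show ?thesis using dist_sgn_self[of z] by auto
    qed
    show ?case
    proof (intro conjI ballI)
      fix a assume "a \<in> S n"
      then have "sgn a \<in> sphere 0 1" "dist a (sgn a) \<le> e"
        using close[of a] d e by (auto simp: norm_sgn)
      then show "\<exists>b\<in>sphere 0 1. dist a b \<le> e" by blast
    next
      fix b :: complex assume b: "b \<in> sphere 0 1"
      obtain z where z: "z \<in> S n" using elim(3) by blast
      then have z0: "z \<noteq> 0" and zd: "dist z (sgn z) \<le> d" using close by auto
      have "norm (b / sgn z) = 1" using b z0 by (simp add: norm_divide norm_sgn)
      then obtain w where w: "w ^ n = 1" "dist w (b / sgn z) \<le> 2 * pi / n"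
        using root_of_unity_near elim(4) by blast
      have w1: "norm w = 1"
        using w(1) elim(4) by (metis norm_one norm_power norm_ge_zero power_eq_1_iff neq0_conv)
      have "w * z - w * sgn z = w * (z - sgn z)" by (simp add: algebra_simps)
      then have "dist (w * z) (w * sgn z) = dist z (sgn z)"
        by (simp add: dist_norm norm_mult w1)
      moreover have "dist (w * sgn z) b = dist w (b / sgn z)"
      proof -
        have "w * sgn z - b = (w - b / sgn z) * sgn z"
          using z0 by (simp add: field_simps sgn_zero_iff)
        then show ?thesis using z0 by (simp add: dist_norm norm_mult norm_sgn)
      qed
      ultimately have "dist (w * z) b \<le> d + 2 * pi / n"
        using dist_triangle[of "w * z" b "w * sgn z"] zd w(2) by linarith
      also have "\<dots> \<le> e" using d elim(1) by linarith
      finally show "\<exists>a\<in>S n. dist a b \<le> e"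
        using rotation[OF w(1) z elim(4)] by blast
    qed
  qed
qed

section \<open>Filled Julia sets\<close>

lemma filled_Julia_image:
  assumes "z \<in> filled_Julia f"
  shows "f z \<in> filled_Julia f"
proof -
  have "(\<lambda>m. (f ^^ m) (f z)) ` {1..} \<subseteq> (\<lambda>m. (f ^^ m) z) ` {1..}"
  proof
    fix y assume "y \<in> (\<lambda>m. (f ^^ m) (f z)) ` {1..}"
    then obtain m where "y = (f ^^ m) (f z)" by blast
    then have "y = (f ^^ Suc m) z" by (simp add: funpow_swap1)
    then show "y \<in> (\<lambda>m. (f ^^ m) z) ` {1..}" by (intro image_eqI[of _ _ "Suc m"]) auto
  qed
  then show ?thesis using assms bounded_subset unfolding filled_Julia_def by blast
qed

lemma filled_Julia_cong_image:
  assumes "f z = f z'" and "z \<in> filled_Julia f"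
  shows "z' \<in> filled_Julia f"
proof -
  have "(f ^^ m) z = (f ^^ m) z'" if "m \<in> {1..}" for m
    using that assms(1) by (cases m) (auto simp: funpow_swap1)
  then have "(\<lambda>m. (f ^^ m) z) ` {1..} = (\<lambda>m. (f ^^ m) z') ` {1..}" by (rule image_cong[OF refl])
  then show ?thesis using assms(2) by (simp add: filled_Julia_def)
qed

lemma subset_filled_Julia:
  assumes "bounded A" and "f ` A \<subseteq> A"
  shows "A \<subseteq> filled_Julia f"
proof
  fix z assume "z \<in> A"
  then have "(f ^^ m) z \<in> A" for m using assms(2) by (induction m) auto
  then have "(\<lambda>m. (f ^^ m) z) ` {1..} \<subseteq> A" by blast
  then show "z \<in> filled_Julia f"
    using assms(1) bounded_subset unfolding filled_Julia_def by blast
qed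

lemma filled_Julia_P_nonempty:
  assumes "n \<ge> 2"
  shows "filled_Julia (P n c) \<noteq> {}"
proof -
  define p where "p = monom 1 n + [:c, - 1:]"
  have poly: "poly p z = z ^ n + c - z" for z by (simp add: p_def poly_monom)
  have "degree [:c, - 1:] < degree (monom (1::complex) n)"
    using assms by (simp add: degree_monom_eq)
  then have "degree p = n" unfolding p_def by (simp add: degree_add_eq_left degree_monom_eq)
  then have "\<not> constant (poly p)" using assms by (simp add: constant_degree)
  then obtain z where "poly p z = 0" using fundamental_theorem_of_algebra by blast
  then have "P n c z = z" by (simp add: P_def poly)
  then have "{z} \<subseteq> filled_Julia (P n c)" by (intro subset_filled_Julia) auto
  then show ?thesis by blast
qed

lemma filled_Julia_P_rotation:
  assumes "w ^ n = 1" and "z \<in> filled_Julia (P n c)"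
  shows "w * z \<in> filled_Julia (P n c)"
  using assms(2) by (rule filled_Julia_cong_image[rotated]) (simp add: P_def power_mult_distrib assms(1))

lemma Julia_P_rotation:
  assumes w: "w ^ n = 1" and n: "n > 0" and z: "z \<in> Julia (P n c)"
  shows "w * z \<in> Julia (P n c)"
proof -
  let ?K = "filled_Julia (P n c)"
  have w0: "w \<noteq> 0" using w n by (auto simp: power_0_left)
  have lin: "linear ((*) w)" by (intro linearI) (auto simp: algebra_simps)
  have inj: "inj ((*) w)" using w0 by (auto intro: injI)
  have "(*) w ` ?K = ?K"
  proof
    show "(*) w ` ?K \<subseteq> ?K" using filled_Julia_P_rotation[OF w] by blast
    show "?K \<subseteq> (*) w ` ?K"
    proof
      fix x assume "x \<in> ?K"
      moreover have "inverse w ^ n = 1" using w by (simp add: power_inverse)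
      ultimately have "inverse w * x \<in> ?K" by (rule filled_Julia_P_rotation[rotated])
      then show "x \<in> (*) w ` ?K" using w0 by (intro image_eqI[of _ _ "inverse w * x"]) auto
    qed
  qed
  then have "(*) w ` frontier ?K = frontier ?K"
    using closure_injective_linear_image[OF lin inj, of ?K]
      interior_injective_linear_image[OF lin inj, of ?K]
    by (simp add: frontier_def image_set_diff[OF inj])
  then show ?thesis using z unfolding Julia_def by blast
qed

section \<open>The escape region\<close>

text \<open>
  The hypothesis is what makes one step at least double the modulus:
  \<open>norm z ^ n \<ge> (2 + norm c) * norm z \<ge> 2 * norm z + norm c\<close>.
\<close>
lemma escape:
  assumes R: "R \<ge> 1" "2 + norm c \<le> R ^ (n - 1)" and n: "n > 0" and z: "norm z \<ge> R"
  shows "z \<notin> filled_Julia (P n c)"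
proof
  assume "z \<in> filled_Julia (P n c)"
  have doubling: "2 * norm y \<le> norm (P n c y)" if y: "norm y \<ge> R" for y
  proof -
    have "2 + norm c \<le> norm y ^ (n - 1)"
      using R(2) power_mono[OF y, of "n - 1"] R(1) by linarith
    then have "norm y * (2 + norm c) \<le> norm y * norm y ^ (n - 1)"
      by (intro mult_left_mono) auto
    also have "\<dots> = norm (y ^ n)" using n by (cases n) (simp_all add: norm_mult norm_power)
    finally have "2 * norm y + norm y * norm c \<le> norm (y ^ n)" by (simp add: algebra_simps)
    moreover have "1 * norm c \<le> norm y * norm c" using y R(1) by (intro mult_right_mono) auto
    moreover have "norm (y ^ n) - norm c \<le> norm (P n c y)"
      unfolding P_def by (metis norm_diff_ineq)
    ultimately show ?thesis by linarith
  qed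
  have growth: "R * 2 ^ m \<le> norm ((P n c ^^ m) z)" for m
  proof (induction m)
    case 0
    then show ?case using z by simp
  next
    case (Suc m)
    have "R * 1 \<le> R * 2 ^ m" using R(1) by (intro mult_left_mono) auto
    then show ?case using doubling[of "(P n c ^^ m) z"] Suc by simp
  qed
  obtain B where B: "\<And>m. m \<ge> 1 \<Longrightarrow> norm ((P n c ^^ m) z) \<le> B"
    using \<open>z \<in> filled_Julia (P n c)\<close> unfolding filled_Julia_def bounded_iff by auto
  obtain m where m: "B < 2 ^ m" using real_arch_pow[of 2 B] by auto
  have "(2::real) ^ m \<le> 2 ^ Suc m" by simp
  also have "\<dots> \<le> R * 2 ^ Suc m" using R(1) by simp
  also have "\<dots> \<le> B" using growth[of "Suc m"] B[of "Suc m"] by simp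
  finally show False using m by simp
qed

lemma eventually_filled_Julia_subset_ball:
  assumes "R > 1"
  shows "\<forall>\<^sub>F n in sequentially. filled_Julia (P n c) \<subseteq> ball 0 R"
proof -
  obtain N where N: "2 + norm c < R ^ N" using real_arch_pow[OF assms] by blast
  show ?thesis using eventually_ge_at_top[of "Suc N"]
  proof eventually_elim
    case (elim n)
    have "R ^ N \<le> R ^ (n - 1)" using elim assms by (intro power_increasing) auto
    then have "2 + norm c \<le> R ^ (n - 1)" using N by linarith
    then have "norm z < R" if "z \<in> filled_Julia (P n c)" for z
      using escape[of R c n z] that assms elim by fastforce
    then show ?case by auto
  qed
qed

lemma eventually_Julia_subset_cball:
  assumes "R > 1"
  shows "\<forall>\<^sub>F n in sequentially. Julia (P n c) \<subseteq> cball 0 R"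
  using eventually_filled_Julia_subset_ball[OF assms, of c]
proof eventually_elim
  case (elim n)
  then have "closure (filled_Julia (P n c)) \<subseteq> cball 0 R"
    by (intro closure_minimal) auto
  then show ?case unfolding Julia_def frontier_def by blast
qed

lemma eventually_Julia_nonempty: "\<forall>\<^sub>F n in sequentially. Julia (P n c) \<noteq> {}"
  using eventually_filled_Julia_subset_ball[of 2 c, simplified] eventually_ge_at_top[of 2]
proof eventually_elim
  case (elim n)
  have "filled_Julia (P n c) \<noteq> UNIV"
  proof
    assume "filled_Julia (P n c) = UNIV"
    then have "(2::complex) \<in> ball 0 2" using elim(1) by blast
    then show False by simp
  qed
  then show ?case
    using filled_Julia_P_nonempty[OF elim(2)] frontier_not_empty unfolding Julia_def by blast
qed

section \<open>The disk inside the unit circle\<close>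

lemma eventually_power_small:
  fixes r d :: real
  assumes "0 \<le> r" "r < 1" "0 < d"
  shows "\<forall>\<^sub>F n in sequentially. r ^ n < d"
  using LIMSEQ_power_zero[of r] assms by (intro order_tendstoD(2)) auto

text \<open>The disk is mapped close to \<open>c\<close>, hence into the escape region.\<close>
lemma eventually_filled_Julia_disjoint_cball:
  assumes c: "norm c > 1" and r: "0 \<le> r" "r < 1"
  shows "\<forall>\<^sub>F n in sequentially. filled_Julia (P n c) \<inter> cball 0 r = {}"
proof -
  define d where "d = (norm c - 1) / 2"
  have d: "d > 0" using c by (simp add: d_def)
  show ?thesis
    using eventually_filled_Julia_subset_ball[of "1 + d" c, simplified, OF d]
      eventually_power_small[OF r d]
  proof eventually_elim
    case (elim n)
    have "norm z > r" if z: "z \<in> filled_Julia (P n c)" for z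
    proof (rule ccontr)
      assume "\<not> norm z > r"
      then have "norm z ^ n \<le> r ^ n" by (intro power_mono) auto
      then have "norm (z ^ n) < d" using elim(2) by (simp add: norm_power)
      moreover have "norm c - norm (z ^ n) \<le> norm (P n c z)"
        unfolding P_def by (metis add.commute norm_diff_ineq)
      moreover have "norm (P n c z) < 1 + d" using filled_Julia_image[OF z] elim(1) by auto
      ultimately show False unfolding d_def by (simp add: field_simps)
    qed
    then show ?case by fastforce
  qed
qed

text \<open>
  The disk of radius \<open>r\<close> need not be invariant when \<open>r \<le> norm c\<close>, but it is contained in the disk
  of radius \<open>s\<close>, the larger of \<open>r\<close> and the midpoint of \<open>norm c\<close> and \<open>1\<close>, which is eventually
  mapped into itself.
\<close>
lemma eventually_cball_subset_filled_Julia: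
  assumes c: "norm c < 1" and r: "r < 1"
  shows "\<forall>\<^sub>F n in sequentially. cball 0 r \<subseteq> filled_Julia (P n c)"
proof -
  define s where "s = max r ((1 + norm c) / 2)"
  have s: "r \<le> s" "s < 1" "norm c < s"
    using c r by (auto simp: s_def less_max_iff_disj)
  then have "0 \<le> s" using norm_ge_zero[of c] by linarith
  have "s - norm c > 0" using s(3) by simp
  from eventually_power_small[OF \<open>0 \<le> s\<close> s(2) this] show ?thesis
  proof eventually_elim
    case (elim n)
    have "norm (P n c z) \<le> s" if "norm z \<le> s" for z
    proof -
      have "norm (P n c z) \<le> norm z ^ n + norm c"
        unfolding P_def by (metis norm_power norm_triangle_ineq)
      also have "norm z ^ n \<le> s ^ n" using that by (intro power_mono) auto
      finally show ?thesis using elim by linarith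
    qed
    then have "cball 0 s \<subseteq> filled_Julia (P n c)" by (intro subset_filled_Julia) auto
    then show ?case using s(1) by (meson order_trans subset_cball)
  qed
qed

section \<open>Limits of Julia sets\<close>

text \<open>
  The outer radius of the annulus is provided by the escape region for every \<open>c\<close>; only the inner
  radius depends on the position of \<open>c\<close>, and it is obtained in opposite ways: the inner disk lies
  in the complement of the filled Julia set if \<open>norm c > 1\<close> and in its interior if \<open>norm c < 1\<close>.
\<close>
lemma hausdorff_limit_Jseq_sphere:
  assumes "\<And>r. \<lbrakk>0 < r; r < 1\<rbrakk> \<Longrightarrow> \<forall>\<^sub>F n in sequentially. Julia (P n c) \<inter> ball 0 r = {}"
  shows "hausdorff_limit (Jseq c) (sphere 0 1)"
proof (rule hausdorff_limit_sphere)
  fix e :: real assume "0 < e" "e < 1"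
  then have "\<forall>\<^sub>F n in sequentially. Julia (P n c) \<inter> ball 0 (1 - e) = {}"
    and "\<forall>\<^sub>F n in sequentially. Julia (P n c) \<subseteq> cball 0 (1 + e)"
    using assms[of "1 - e"] eventually_Julia_subset_cball[of "1 + e" c] by auto
  then show "\<forall>\<^sub>F n in sequentially. \<forall>z\<in>Julia (P n c). 1 - e \<le> norm z \<and> norm z \<le> 1 + e"
    by eventually_elim force
qed (use eventually_Julia_nonempty Julia_P_rotation in auto)

lemma frontier_Int_ball_empty:
  assumes "A \<inter> ball x r = {} \<or> ball x r \<subseteq> A"
  shows "frontier A \<inter> ball x r = {}"
  using assms
proof
  assume "A \<inter> ball x r = {}"
  then have "closure A \<inter> ball x r = {}"
    using open_Int_closure_eq_empty[OF open_ball] by (metis inf_commute)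
  then show ?thesis unfolding frontier_def by blast
next
  assume "ball x r \<subseteq> A"
  then have "ball x r \<subseteq> interior A" by (simp add: interior_maximal)
  then show ?thesis unfolding frontier_def by blast
qed

lemma hausdorff_limits_outside:
  assumes c: "norm c > 1"
  shows "hausdorff_limit (Jseq c) (sphere 0 1)" "hausdorff_limit (Kseq c) (sphere 0 1)"
proof -
  have disj: "\<forall>\<^sub>F n in sequentially. filled_Julia (P n c) \<inter> ball 0 r = {}" if "0 < r" "r < 1" for r
    using eventually_filled_Julia_disjoint_cball[OF c less_imp_le[OF that(1)] that(2)]
  proof eventually_elim
    case (elim n)
    then show ?case using ball_subset_cball[of 0 r] by blast
  qed
  show "hausdorff_limit (Jseq c) (sphere 0 1)"
  proof (rule hausdorff_limit_Jseq_sphere)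
    fix r :: real assume "0 < r" "r < 1"
    from disj[OF this] show "\<forall>\<^sub>F n in sequentially. Julia (P n c) \<inter> ball 0 r = {}"
      unfolding Julia_def by eventually_elim (rule frontier_Int_ball_empty, blast)
  qed
  show "hausdorff_limit (Kseq c) (sphere 0 1)"
  proof (rule hausdorff_limit_sphere)
    fix e :: real assume "0 < e" "e < 1"
    then have "\<forall>\<^sub>F n in sequentially. filled_Julia (P n c) \<inter> ball 0 (1 - e) = {}"
      and "\<forall>\<^sub>F n in sequentially. filled_Julia (P n c) \<subseteq> ball 0 (1 + e)"
      using disj[of "1 - e"] eventually_filled_Julia_subset_ball[of "1 + e" c] by auto
    then show "\<forall>\<^sub>F n in sequentially. \<forall>z\<in>filled_Julia (P n c). 1 - e \<le> norm z \<and> norm z \<le> 1 + e"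
      by eventually_elim force
  next
    show "\<forall>\<^sub>F n in sequentially. filled_Julia (P n c) \<noteq> {}"
      using eventually_ge_at_top[of 2] by eventually_elim (rule filled_Julia_P_nonempty)
  qed (use filled_Julia_P_rotation in auto)
qed

lemma hausdorff_limits_inside:
  assumes c: "norm c < 1"
  shows "hausdorff_limit (Jseq c) (sphere 0 1)" "hausdorff_limit (Kseq c) (cball 0 1)"
proof -
  show "hausdorff_limit (Jseq c) (sphere 0 1)"
  proof (rule hausdorff_limit_Jseq_sphere)
    fix r :: real assume "0 < r" "r < 1"
    from eventually_cball_subset_filled_Julia[OF c this(2)]
    show "\<forall>\<^sub>F n in sequentially. Julia (P n c) \<inter> ball 0 r = {}"
      unfolding Julia_def
      by eventually_elim (rule frontier_Int_ball_empty, use ball_subset_cball in blast)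
  qed
  show "hausdorff_limit (Kseq c) (cball 0 1)"
  proof (rule hausdorff_limitI)
    fix e :: real assume e: "e > 0"
    \<comment> \<open>Scaling by \<open>r\<close> moves the closed unit disk into the filled Julia set; the truncation at \<open>0\<close>
        keeps the image inside the disk of radius \<open>r\<close> when \<open>e > 1\<close>.\<close>
    define r where "r = max 0 (1 - e)"
    have r: "0 \<le> r" "r < 1" "1 - r \<le> e" and "1 + e > 1" using e by (auto simp: r_def)
    from eventually_cball_subset_filled_Julia[OF c r(2)]
      eventually_filled_Julia_subset_ball[OF this(4), of c]
    show "\<forall>\<^sub>F n in sequentially. (\<forall>a\<in>filled_Julia (P n c). \<exists>b\<in>cball 0 1. dist a b \<le> e) \<and>
        (\<forall>b\<in>cball 0 1. \<exists>a\<in>filled_Julia (P n c). dist a b \<le> e)"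
    proof eventually_elim
      case (elim n)
      show ?case
      proof (intro conjI ballI)
        fix a assume "a \<in> filled_Julia (P n c)"
        then have a: "norm a < 1 + e" using elim(2) by auto
        show "\<exists>b\<in>cball 0 1. dist a b \<le> e"
        proof (cases "norm a \<le> 1")
          case True
          then show ?thesis using e by (intro bexI[of _ a]) auto
        next
          case False
          then have "a \<noteq> 0" by auto
          then have "dist a (sgn a) \<le> e" using dist_sgn_self[of a] a False by simp
          then show ?thesis using \<open>a \<noteq> 0\<close> by (intro bexI[of _ "sgn a"]) (auto simp: norm_sgn)
        qed
      next
        fix b :: complex assume b: "b \<in> cball 0 1"
        then have "r * norm b \<le> r" using r(1) by (simp add: mult_left_le)
        then have "r *\<^sub>R b \<in> filled_Julia (P n c)" using elim(1) r(1) by auto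
        moreover have "dist (r *\<^sub>R b) b \<le> e"
        proof -
          have "b - r *\<^sub>R b = (1 - r) *\<^sub>R b" by (simp add: algebra_simps)
          then have "dist (r *\<^sub>R b) b = (1 - r) * norm b"
            using r(2) by (simp add: dist_norm norm_minus_commute)
          also have "\<dots> \<le> 1 - r" using b r(2) by (simp add: mult_left_le)
          finally show ?thesis using r(3) by linarith
        qed
        ultimately show "\<exists>a\<in>filled_Julia (P n c). dist a b \<le> e" by blast
      qed
    qed
  qed
qed

theorem theorem1p2:
  fixes c :: complex
  shows
    "(c \<in> UNIV - cball 0 1 \<longrightarrow>
        hausdorff_limit (Jseq c) (sphere 0 1) \<and> hausdorff_limit (Kseq c) (sphere 0 1)) \<and>
     (c \<in> ball 0 1 \<longrightarrow>
        hausdorff_limit (Jseq c) (sphere 0 1) \<and> hausdorff_limit (Kseq c) (cball 0 1)) \<and>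
     (c \<in> sphere 0 1 \<longrightarrow>
        (\<forall>L. compact L \<and> hausdorff_limit (Jseq c) L \<longrightarrow> L \<subseteq> cball 0 1) \<and>
        (\<forall>L. compact L \<and> hausdorff_limit (Kseq c) L \<longrightarrow> L \<subseteq> cball 0 1) \<and>
        set_liminf (Jseq c) \<subseteq> cball 0 1 \<and> set_limsup (Jseq c) \<subseteq> cball 0 1 \<and>
        set_liminf (Kseq c) \<subseteq> cball 0 1 \<and> set_limsup (Kseq c) \<subseteq> cball 0 1)"
proof -
  have J: "set_limsup (Jseq c) \<subseteq> cball 0 1"
    by (rule set_limsup_subset_cball) (rule eventually_Julia_subset_cball)
  have K: "set_limsup (Kseq c) \<subseteq> cball 0 1"
  proof (rule set_limsup_subset_cball)
    fix R :: real assume "R > 1"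
    from eventually_filled_Julia_subset_ball[OF this, of c]
    show "\<forall>\<^sub>F n in sequentially. filled_Julia (P n c) \<subseteq> cball 0 R"
      by eventually_elim (use ball_subset_cball in blast)
  qed
  have "L \<subseteq> cball 0 1" if "hausdorff_limit (Jseq c) L" for L
    using hausdorff_limit_subset_set_liminf[OF that] set_liminf_subset_set_limsup[of "Jseq c"] J
    by blast
  moreover have "L \<subseteq> cball 0 1" if "hausdorff_limit (Kseq c) L" for L
    using hausdorff_limit_subset_set_liminf[OF that] set_liminf_subset_set_limsup[of "Kseq c"] K
    by blast
  moreover have "set_liminf (Jseq c) \<subseteq> cball 0 1" "set_liminf (Kseq c) \<subseteq> cball 0 1"
    using set_liminf_subset_set_limsup[of "Jseq c"] set_liminf_subset_set_limsup[of "Kseq c"] J K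
    by blast+
  ultimately show ?thesis
    using J K hausdorff_limits_outside[of c] hausdorff_limits_inside[of c] by simp
qed

end
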